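(* Let $H$ be the complement of the cycle on seven vertices, i.e. the graph with vertex set $\mathbb Z_7$ in which $u,v$ are adjacent exactly when their cyclic distance is two or three. Then $$\mathrm{lrw}(H)=2\qquad\text{and}\qquad \mathrm{lsfw}(H)=8 .$$ Consequently, the inequality $\mathrm{lsfw}(G)\le 2\,\mathrm{lrw}(G)+2$ does not hold for all graphs $G$.
   Context: All graphs are finite, simple and undirected. Both parameters are assigned value $0$ on the empty graph. Linear rank-width. For $X\subseteq V(G)$ the cutrank $\rho_G(X)$ is the rank over $\mathbb F_2$ of the $X\times (V(G)\setminus X)$ adjacency matrix. For a linear order $\pi=(v_1,\dots,v_n)$ of $V(G)$ put $P_i=\{v_1,\dots,v_i\}$ for $0\le i\le n$. Then $\mathrm{lrw}(G)=\min_\pi\max_i\rho_G(P_i)$, the minimum over all linear orders $\pi$ of $V(G)$. Sequential cable plays. A configuration on $G$ consists of the set of born vertices, a family $\mathcal L$ of pairwise disjoint nonempty sets of born vertices (the live cables), and a set of already placed edges; initially all are empty. With $\ell=|\mathcal L|$ the number of live cables before a move, the moves are: (i) birth$(S)$: introduces a nonempty set $S$ of fresh (not yet born) vertices of $G$ as one live cable; cost $2\ell+1$. (ii) fold$(X,Y)$: replaces two distinct live cables $X,Y$ by $X\cup Y$; cost $2\ell-1$. (iii) block$(X,Y)$: places every edge between two distinct live cables $X,Y$; legal when all these pairs are edges of $G$ and at least one has not already been placed; cost $2\ell$. (iv) clique$(X)$: places every edge inside a live cable $X$; legal when $X$ is a clique of $G$ and at least one internal edge has not already been placed; cost $2\ell$.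 (v) close$(X)$: removes the live cable $X$; legal when every edge of $G$ incident with a vertex of $X$ has already been placed; cost $2\ell-1$. A play (a finite sequence of legal moves from the initial configuration) constructs $G$ if every vertex is born, every edge of $G$ is placed, and every cable is closed. The width of a play is the maximum cost of its moves, and $\mathrm{lsfw}(G)$ is the minimum width of a play constructing $G$. *)

theory Defs
  imports Complex_Main "HOL-Library.Z2" "HOL-Library.Function_Algebras" "HOL-Library.Ramsey"
begin

record 'a ugraph =
  verts :: "'a set"
  edges :: "'a set set"

definition simple_graph :: "'a ugraph \<Rightarrow> bool" where
  "simple_graph G \<longleftrightarrow> finite (verts G) \<and> edges G \<subseteq> [verts G]\<^bsup>2\<^esup>"

definition complement_graph :: "'a ugraph \<Rightarrow> 'a ugraph" where
  "complement_graph G = \<lparr>verts = verts G, edges = [verts G]\<^bsup>2\<^esup> - edges G\<rparr>"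


section \<open>Linear rank-width\<close>

global_interpretation bit_fun: vector_space "\<lambda>(c::bit) (f::'a \<Rightarrow> bit) x. c * f x"
  by standard (auto simp: fun_eq_iff algebra_simps)

text \<open>
  The rank of the submatrix of \<open>A\<close> with rows \<open>I\<close> and columns \<open>J\<close>, as the dimension over
  the two-element field \<^typ>\<open>bit\<close> of its row space. Each row is a vector indexed by \<open>J\<close>,
  extended by zero to a function on the whole type.
\<close>
definition rank_on :: "'a set \<Rightarrow> 'b set \<Rightarrow> ('a \<Rightarrow> 'b \<Rightarrow> bit) \<Rightarrow> nat" where
  "rank_on I J A = bit_fun.dim ((\<lambda>i j. if j \<in> J then A i j else 0) ` I)"

definition adjacency :: "'a ugraph \<Rightarrow> 'a \<Rightarrow> 'a \<Rightarrow> bit" where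
  "adjacency G u v = of_bool ({u, v} \<in> edges G)"

definition cutrank :: "'a ugraph \<Rightarrow> 'a set \<Rightarrow> nat" where
  "cutrank G X = rank_on X (verts G - X) (adjacency G)"

definition linear_orders :: "'a ugraph \<Rightarrow> 'a list set" where
  "linear_orders G = {vs. distinct vs \<and> set vs = verts G}"

text \<open>The index \<open>i = 0\<close> is included, so the empty graph gets the value \<open>0\<close>.\<close>
definition lrw :: "'a ugraph \<Rightarrow> nat" where
  "lrw G = Min ((\<lambda>vs. Max ((\<lambda>i. cutrank G (set (take i vs))) ` {0..length vs})) ` linear_orders G)"


section \<open>Sequential cable plays\<close>

record 'a config =
  born :: "'a set"
  live :: "'a set set"
  placed :: "'a set set"

definition initial :: "'a config" where
  "initial = \<lparr>born = {}, live = {}, placed = {}\<rparr>"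

datatype 'a move =
    Birth "'a set"
  | Fold "'a set" "'a set"
  | Block "'a set" "'a set"
  | Clique "'a set"
  | Close "'a set"

definition pairs_between :: "'a set \<Rightarrow> 'a set \<Rightarrow> 'a set set" where
  "pairs_between X Y = {{x, y} | x y. x \<in> X \<and> y \<in> Y}"

fun legal :: "'a ugraph \<Rightarrow> 'a config \<Rightarrow> 'a move \<Rightarrow> bool" where
  "legal G c (Birth S) \<longleftrightarrow> S \<noteq> {} \<and> S \<subseteq> verts G - born c"
| "legal G c (Fold X Y) \<longleftrightarrow> X \<in> live c \<and> Y \<in> live c \<and> X \<noteq> Y"
| "legal G c (Block X Y) \<longleftrightarrow> X \<in> live c \<and> Y \<in> live c \<and> X \<noteq> Y \<and>
     pairs_between X Y \<subseteq> edges G \<and> \<not> pairs_between X Y \<subseteq> placed c"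
| "legal G c (Clique X) \<longleftrightarrow> X \<in> live c \<and> clique X (edges G) \<and> \<not> [X]\<^bsup>2\<^esup> \<subseteq> placed c"
| "legal G c (Close X) \<longleftrightarrow> X \<in> live c \<and> {e \<in> edges G. e \<inter> X \<noteq> {}} \<subseteq> placed c"

fun apply_move :: "'a config \<Rightarrow> 'a move \<Rightarrow> 'a config" where
  "apply_move c (Birth S) = c\<lparr>born := born c \<union> S, live := insert S (live c)\<rparr>"
| "apply_move c (Fold X Y) = c\<lparr>live := insert (X \<union> Y) (live c - {X, Y})\<rparr>"
| "apply_move c (Block X Y) = c\<lparr>placed := placed c \<union> pairs_between X Y\<rparr>"
| "apply_move c (Clique X) = c\<lparr>placed := placed c \<union> [X]\<^bsup>2\<^esup>\<rparr>"
| "apply_move c (Close X) = c\<lparr>live := live c - {X}\<rparr>"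

text \<open>
  The truncated subtractions are harmless: a legal fold has at least two live cables,
  a legal close at least one.
\<close>
fun cost :: "'a config \<Rightarrow> 'a move \<Rightarrow> nat" where
  "cost c (Birth S) = 2 * card (live c) + 1"
| "cost c (Fold X Y) = 2 * card (live c) - 1"
| "cost c (Block X Y) = 2 * card (live c)"
| "cost c (Clique X) = 2 * card (live c)"
| "cost c (Close X) = 2 * card (live c) - 1"

primrec legal_from :: "'a ugraph \<Rightarrow> 'a config \<Rightarrow> 'a move list \<Rightarrow> bool" where
  "legal_from G c [] \<longleftrightarrow> True"
| "legal_from G c (m # ms) \<longleftrightarrow> legal G c m \<and> legal_from G (apply_move c m) ms"

primrec costs_from :: "'a config \<Rightarrow> 'a move list \<Rightarrow> nat list" where
  "costs_from c [] = []"
| "costs_from c (m # ms) = cost c m # costs_from (apply_move c m) ms"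

definition is_play :: "'a ugraph \<Rightarrow> 'a move list \<Rightarrow> bool" where
  "is_play G ms \<longleftrightarrow> legal_from G initial ms"

definition constructs :: "'a move list \<Rightarrow> 'a ugraph \<Rightarrow> bool" where
  "constructs ms G \<longleftrightarrow> is_play G ms \<and>
     (let c = foldl apply_move initial ms
      in born c = verts G \<and> placed c = edges G \<and> live c = {})"

text \<open>
  The \<open>0\<close> only matters for the empty play, which constructs the empty graph; thus \<open>lsfw\<close>
  of the empty graph is \<open>0\<close>.
\<close>
definition width :: "'a move list \<Rightarrow> nat" where
  "width ms = Max (insert 0 (set (costs_from initial ms)))"

definition lsfw :: "'a ugraph \<Rightarrow> nat" where
  "lsfw G = (LEAST w. \<exists>ms. constructs ms G \<and> width ms = w)"


section \<open>The complement of the seven-cycle\<close>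

text \<open>Residues modulo \<open>n\<close> are represented by the integers \<open>0, \<dots>, n - 1\<close>.\<close>
definition cyclic_dist :: "int \<Rightarrow> int \<Rightarrow> int \<Rightarrow> int" where
  "cyclic_dist n u v = min ((u - v) mod n) ((v - u) mod n)"

definition cycle7 :: "int ugraph" where
  "cycle7 = \<lparr>verts = {0..<7},
     edges = {{u, v} | u v. u \<in> {0..<7} \<and> v \<in> {0..<7} \<and> cyclic_dist 7 u v = 1}\<rparr>"

definition H7 :: "int ugraph" where
  "H7 = \<lparr>verts = {0..<7},
     edges = {{u, v} | u v. u \<in> {0..<7} \<and> v \<in> {0..<7} \<and> cyclic_dist 7 u v \<in> {2, 3}}\<rparr>"

lemma cyclic_dist_commute: "cyclic_dist n u v = cyclic_dist n v u"
  by (simp add: cyclic_dist_def min.commute)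

lemma residues7: "{0..<7::int} = {0, 1, 2, 3, 4, 5, 6}"
  by (simp add: set_eq_iff) presburger

lemma cyclic_dist7_cases:
  assumes "u \<in> {0..<7}" "v \<in> {0..<7}"
  shows "cyclic_dist 7 u v = 0 \<longleftrightarrow> u = v"
    and "cyclic_dist 7 u v \<in> {0, 1, 2, 3}"
  using assms unfolding residues7 cyclic_dist_def by auto

lemma simple_graph_H7: "simple_graph H7"
proof -
  have "edges H7 \<subseteq> [verts H7]\<^bsup>2\<^esup>"
    using cyclic_dist7_cases(1) by (fastforce simp: H7_def nsets_2_eq)
  then show ?thesis by (simp add: simple_graph_def H7_def)
qed

lemma H7_eq_complement_cycle7: "H7 = complement_graph cycle7"
proof -
  have E: "{u, v} \<in> {{u, v} | u v. u \<in> {0..<7} \<and> v \<in> {0..<7} \<and> cyclic_dist 7 u v \<in> D}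
      \<longleftrightarrow> u \<in> {0..<7} \<and> v \<in> {0..<7} \<and> cyclic_dist 7 u v \<in> D" for u v :: int and D
    using cyclic_dist_commute[of 7] by (auto simp: doubleton_eq_iff)
  have E2: "{u, v} \<in> edges H7 \<longleftrightarrow> u \<in> {0..<7} \<and> v \<in> {0..<7} \<and> cyclic_dist 7 u v \<in> {2, 3}"
    and E1: "{u, v} \<in> edges cycle7 \<longleftrightarrow> u \<in> {0..<7} \<and> v \<in> {0..<7} \<and> cyclic_dist 7 u v = 1" for u v
    using E[of u v "{2, 3}"] E[of u v "{1}"] by (simp_all add: H7_def cycle7_def)
  have "edges H7 = [{0..<7}]\<^bsup>2\<^esup> - edges cycle7"
  proof (intro set_eqI iffI)
    fix e assume e: "e \<in> edges H7"
    then obtain u v where uv: "e = {u, v}" by (auto simp: H7_def)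
    with e E2[of u v] E1[of u v] cyclic_dist7_cases(1)[of u v] simple_graph_H7
    show "e \<in> [{0..<7}]\<^bsup>2\<^esup> - edges cycle7"
      by (auto simp: simple_graph_def H7_def)
  next
    fix e assume e: "e \<in> [{0..<7}]\<^bsup>2\<^esup> - edges cycle7"
    then obtain u v where uv: "e = {u, v}" "u \<in> {0..<7}" "v \<in> {0..<7}" "u \<noteq> v"
      by (auto elim: nsets2_E)
    with e E2[of u v] E1[of u v] cyclic_dist7_cases[of u v] show "e \<in> edges H7"
      by auto
  qed
  then show ?thesis by (simp add: complement_graph_def H7_def cycle7_def)
qed

end

(*
  In H7 no two vertices have comparable neighbourhoods and every degree is 4. While every move
  costs at most 7, edges are placed only with at most three live cables and a birth leaves at
  most four. A cable containing x and y can never be closed if some unplaced edge xz has no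
  counterpart yz. Incomparability therefore forces the first four births to be singletons, and a
  fold of {x}, {y} needs two placed edges xz, yz' covering all four born vertices; but the
  vertex born fourth has no placed edge yet. With at most four vertices born nothing can be
  closed either, so the play is stuck.

  For the rank, incomparability makes the first two rows of any order independent, while
  along 0, 1, 4, 3, 2, 5, 6 every row lies in the span of the rows of 0 and 1.
*)

theory Submission
  imports Defs
begin

section \<open>Invariants that rule out plays of width at most 7\<close>

section \<open>A lower bound for cable plays\<close>

text \<open>An antichain in the vicinal preorder: N(x) - {y} never lies in N(y), and symmetrically.
  Excluding \<open>z = y\<close> matters for adjacent x and y, since otherwise y itself would be a
  trivial witness.\<close>

definition incomparable_nbhds :: "'a ugraph \<Rightarrow> bool" where
  "incomparable_nbhds G \<longleftrightarrow>
    (\<forall>x\<in>verts G. \<forall>y\<in>verts G. x \<noteq> y \<longrightarrow> (\<exists>z. z \<noteq> y \<and> {x, z} \<in> edges G \<and> {y, z} \<notin> edges G))"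

text \<open>The type of configurations does not enforce disjointness. The clause on born vertices
  keeps it intact when fresh vertices enter.\<close>

definition disjoint_cables :: "'a config \<Rightarrow> bool" where
  "disjoint_cables c \<longleftrightarrow> \<Union>(live c) \<subseteq> born c \<and>
    (\<forall>X\<in>live c. \<forall>Y\<in>live c. X \<inter> Y \<noteq> {} \<longrightarrow> X = Y)"

text \<open>A permanent obstruction to finishing: x and y are tied to the same future moves, but
  only x still needs an edge to z. The vertex z may be unborn.\<close>

definition doomed :: "'a ugraph \<Rightarrow> 'a config \<Rightarrow> bool" where
  "doomed G c \<longleftrightarrow> (\<exists>X\<in>live c. \<exists>x\<in>X. \<exists>y\<in>X. \<exists>z.
     z \<noteq> y \<and> {x, z} \<in> edges G \<and> {x, z} \<notin> placed c \<and> {y, z} \<notin> edges G)"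

text \<open>The last clause records the vertex born fourth: with four live cables a block or clique
  costs 8, so none of its edges can be placed cheaply.\<close>

definition early :: "'a ugraph \<Rightarrow> 'a config \<Rightarrow> bool" where
  "early G c \<longleftrightarrow> live c = (\<lambda>v. {v}) ` born c \<and> born c \<subseteq> verts G \<and> card (born c) \<le> 4 \<and>
     \<Union>(placed c) \<subseteq> born c \<and> (card (born c) = 4 \<longrightarrow> (\<exists>w\<in>born c. w \<notin> \<Union>(placed c)))"

lemma disjoint_cables_placed [simp]: "disjoint_cables (c\<lparr>placed := P\<rparr>) = disjoint_cables c"
  by (simp add: disjoint_cables_def)

lemma disjoint_cables_step:
  assumes "disjoint_cables c" "legal G c m"
  shows "disjoint_cables (apply_move c m)"
proof (cases m)
  case (Birth S)
  then have "S \<inter> X = {}" "X \<inter> S = {}" if "X \<in> live c" for X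
    using assms that unfolding disjoint_cables_def by fastforce+
  then show ?thesis using Birth assms by (simp add: disjoint_cables_def le_supI1)
next
  case (Fold X Y)
  then show ?thesis using assms unfolding disjoint_cables_def
    by (simp add: Int_Un_distrib Int_Un_distrib2) blast
next
  case (Close X)
  then show ?thesis using assms unfolding disjoint_cables_def by simp blast
qed (use assms in simp_all)

text \<open>By disjointness only X contains x, so a block or clique placing xz would also place the
  non-edge yz. A fold can only enlarge X, and closing X requires xz.\<close>

lemma doomed_step:
  assumes dj: "disjoint_cables c" and d: "doomed G c" and l: "legal G c m"
  shows "doomed G (apply_move c m)"
proof -
  from d obtain X x y z where X: "X \<in> live c" "x \<in> X" "y \<in> X" and z: "z \<noteq> y"
    "{x, z} \<in> edges G" "{x, z} \<notin> placed c" "{y, z} \<notin> edges G"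
    unfolding doomed_def by blast
  have same: "Y = X" if "Y \<in> live c" "x \<in> Y" for Y
    using dj X that unfolding disjoint_cables_def by blast
  show ?thesis
  proof (cases m)
    case (Birth S)
    then have "X \<in> live (apply_move c m)" "placed (apply_move c m) = placed c" using X by auto
    then show ?thesis using X z unfolding doomed_def by metis
  next
    case (Fold Y Z)
    then obtain W where "W \<in> live (apply_move c m)" "x \<in> W" "y \<in> W"
      using X by auto
    moreover have "placed (apply_move c m) = placed c" using Fold by simp
    ultimately show ?thesis using z unfolding doomed_def by metis
  next
    case (Block Y Z)
    have "{x, z} \<notin> pairs_between Y Z"
    proof
      assume "{x, z} \<in> pairs_between Y Z"
      then have "x \<in> Y \<and> z \<in> Z \<or> x \<in> Z \<and> z \<in> Y"
        by (auto simp: pairs_between_def doubleton_eq_iff)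
      then have "X = Y \<and> z \<in> Z \<or> X = Z \<and> z \<in> Y" using same l Block by auto
      then have "{y, z} \<in> pairs_between Y Z" using X
        by (auto simp: pairs_between_def doubleton_eq_iff)
      then show False using l Block z by auto
    qed
    then show ?thesis using X z Block unfolding doomed_def by auto
  next
    case (Clique Y)
    have "{x, z} \<notin> [Y]\<^bsup>2\<^esup>"
    proof
      assume "{x, z} \<in> [Y]\<^bsup>2\<^esup>"
      then have xz: "x \<in> Y" "z \<in> Y" by (auto simp: nsets_def)
      then have "Y = X" using same l Clique by auto
      then show False using l Clique z X xz by (auto simp: clique_def)
    qed
    then show ?thesis using X z Clique unfolding doomed_def by auto
  next
    case (Close Y)
    then have "Y \<noteq> X" using l X z by auto
    then show ?thesis using X z Close unfolding doomed_def by auto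
  qed
qed

text \<open>With singleton cables, live cables and born vertices are equal in number, so births,
  blocks and cliques are affordable only with at most three born. Folds and closes remain affordable
  with four: the former doom the play, the latter are illegal.\<close>

lemma early_step:
  assumes G: "simple_graph G" "incomparable_nbhds G"
    and deg: "\<forall>v\<in>verts G. 4 \<le> card {u. {v, u} \<in> edges G}"
    and e: "early G c" and l: "legal G c m" and cost: "cost c m \<le> 7"
  shows "early G (apply_move c m) \<or> doomed G (apply_move c m)"
proof -
  have lv: "live c = (\<lambda>v. {v}) ` born c" and bv: "born c \<subseteq> verts G" and b4: "card (born c) \<le> 4"
    and pb: "\<Union>(placed c) \<subseteq> born c"
    using e by (auto simp: early_def)
  have fin: "finite (born c)"
    using bv G(1) finite_subset unfolding simple_graph_def by blast
  have cl: "card (live c) = card (born c)"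
    unfolding lv by (rule card_image) (simp add: inj_on_def)
  note sep = G(2)[unfolded incomparable_nbhds_def, rule_format]
  show ?thesis
  proof (cases m)
    case (Birth S)
    then have S: "S \<noteq> {}" "S \<subseteq> verts G" "S \<inter> born c = {}" and b3: "card (born c) \<le> 3"
      using l cost cl by auto
    show ?thesis
    proof (cases "\<exists>x\<in>S. \<exists>y\<in>S. x \<noteq> y")
      case True
      then obtain x y where xy: "x \<in> S" "y \<in> S" "x \<noteq> y" by blast
      then obtain z where "z \<noteq> y" "{x, z} \<in> edges G" "{y, z} \<notin> edges G"
        using sep S(2) by blast
      moreover have "{x, z} \<notin> placed c" using pb xy S(3) by auto
      ultimately have "doomed G (apply_move c m)"
        using Birth xy unfolding doomed_def by auto
      then show ?thesis ..
    next
      case False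
      \<comment> \<open>The new vertex v witnesses the last clause of \<open>early\<close>, since
        placed edges lie among the vertices born before it.\<close>
      then obtain v where v: "S = {v}" using S(1) by blast
      then have "early G (apply_move c m)"
        using Birth S b3 bv pb lv fin unfolding early_def by auto
      then show ?thesis ..
    qed
  next
    case (Fold X Y)
    then obtain x y where xy: "X = {x}" "Y = {y}" "x \<in> born c" "y \<in> born c" "x \<noteq> y"
      using l lv by auto
    obtain z where z: "z \<noteq> y" "{x, z} \<in> edges G" "{y, z} \<notin> edges G"
      using sep xy bv by blast
    obtain z' where z': "z' \<noteq> x" "{y, z'} \<in> edges G" "{x, z'} \<notin> edges G"
      using sep[of y x] xy bv by auto
    have loop: "{u} \<notin> edges G" for u
      using G(1) by (auto simp: simple_graph_def nsets_def)
    have "doomed G (apply_move c m)"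
    proof (rule ccontr)
      assume nd: "\<not> doomed G (apply_move c m)"
      \<comment> \<open>After the fold x and y share a cable, so leaving xz or yz' unplaced would
        doom the configuration.\<close>
      have pl: "{x, z} \<in> placed c" "{y, z'} \<in> placed c"
        using nd z z' Fold xy unfolding doomed_def by auto
      then have sub: "{x, y, z, z'} \<subseteq> born c" using pb xy by auto
      \<comment> \<open>The vertices z and z' differ because xz is an edge and xz' is not; the other
        two inequalities exclude loops.\<close>
      have "z \<noteq> x" "z' \<noteq> y" "z \<noteq> z'" using z z' loop by auto
      then have c4: "card {x, y, z, z'} = 4" using z z' xy by auto
      then have "card (born c) = 4" using card_mono[OF fin sub] b4 by simp
      then obtain w where w: "w \<in> born c" "w \<notin> \<Union>(placed c)" using e by (auto simp: early_def)
      have "{x, y, z, z'} = born c"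
        using card_subset_eq[OF fin sub] c4 \<open>card (born c) = 4\<close> by simp
      then show False using w pl by blast
    qed
    then show ?thesis ..
  next
    case (Block X Y)
    \<comment> \<open>At most three vertices are born, so the clause of \<open>early\<close> about
      four is vacuous before and after the move.\<close>
    then have "card (born c) \<le> 3" using cost cl by simp
    moreover have "\<Union>(pairs_between X Y) \<subseteq> born c"
      using Block l lv by (auto simp: pairs_between_def)
    ultimately have "early G (apply_move c m)" using e Block unfolding early_def by auto
    then show ?thesis ..
  next
    case (Clique X)
    then have "card (born c) \<le> 3" using cost cl by simp
    moreover have "\<Union>([X]\<^bsup>2\<^esup>) \<subseteq> born c"
      using Clique l lv by (auto simp: nsets_def)
    ultimately have "early G (apply_move c m)" using e Clique unfolding early_def by auto
    then show ?thesis ..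
  next
    case (Close X)
    then obtain x where x: "X = {x}" "x \<in> born c" using l lv by auto
    let ?N = "{u. {x, u} \<in> edges G}"
    \<comment> \<open>All edges at x must be placed, so x and its at least four neighbours would be
      five born vertices.\<close>
    have "?N \<subseteq> born c" using l Close x pb by auto
    moreover have "x \<notin> ?N" using G(1) by (auto simp: simple_graph_def nsets_def)
    ultimately have "card (insert x ?N) = Suc (card ?N)" "insert x ?N \<subseteq> born c"
      using finite_subset[OF _ fin] x(2) by (simp_all add: card_insert_disjoint)
    moreover have "4 \<le> card ?N" using deg bv x(2) by blast
    ultimately have False using card_mono[OF fin, of "insert x ?N"] b4 by simp
    then show ?thesis ..
  qed
qed

lemma early_imp_disjoint_cables: "early G c \<Longrightarrow> disjoint_cables c"
  by (auto simp: early_def disjoint_cables_def)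

lemma early_or_doomed_play:
  assumes "simple_graph G" "incomparable_nbhds G"
    and "\<forall>v\<in>verts G. 4 \<le> card {u. {v, u} \<in> edges G}"
    and "legal_from G c ms" "\<forall>k\<in>set (costs_from c ms). k \<le> 7"
    and "disjoint_cables c" "early G c \<or> doomed G c"
  shows "early G (foldl apply_move c ms) \<or> doomed G (foldl apply_move c ms)"
  using assms(4-)
proof (induction ms arbitrary: c)
  case (Cons m ms)
  have "early G (apply_move c m) \<or> doomed G (apply_move c m)"
    using Cons.prems early_step[OF assms(1-3), of c m] doomed_step[of c G m] by auto
  then have "early G (foldl apply_move (apply_move c m) ms) \<or>
      doomed G (foldl apply_move (apply_move c m) ms)"
    using Cons.prems disjoint_cables_step[of c G m] by (intro Cons.IH) auto
  then show ?case by simp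
qed simp

lemma width_ge_8:
  assumes "simple_graph G" "incomparable_nbhds G" "verts G \<noteq> {}"
    and "\<forall>v\<in>verts G. 4 \<le> card {u. {v, u} \<in> edges G}"
    and c: "constructs ms G"
  shows "8 \<le> width ms"
proof (rule ccontr)
  assume "\<not> 8 \<le> width ms"
  moreover have "\<forall>k\<in>set (costs_from initial ms). k \<le> width ms"
    by (auto simp: width_def)
  ultimately have "\<forall>k\<in>set (costs_from initial ms). k \<le> 7" by force
  moreover have "early G initial" by (simp add: early_def initial_def)
  ultimately have "early G (foldl apply_move initial ms) \<or> doomed G (foldl apply_move initial ms)"
    using c by (intro early_or_doomed_play[OF assms(1,2,4)] early_imp_disjoint_cables)
      (auto simp: constructs_def is_play_def)
  \<comment> \<open>A final configuration has no live cable, so it is not doomed, and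
    \<open>early\<close> would force its born set, which is \<open>verts G\<close>, to be
    empty.\<close>
  then show False
    using c assms(3) by (auto simp: constructs_def Let_def early_def doomed_def)
qed


section \<open>Plays built backwards from the final configuration\<close>

section \<open>Upper bounds from plays\<close>

text \<open>Hiding the remaining moves behind an existential lets an explicit play be verified one
  move at a time, last move first.\<close>

definition completable :: "'a ugraph \<Rightarrow> nat \<Rightarrow> 'a config \<Rightarrow> bool" where
  "completable G k c \<longleftrightarrow> (\<exists>ms. legal_from G c ms \<and> (\<forall>x\<in>set (costs_from c ms). x \<le> k) \<and>
     foldl apply_move c ms = \<lparr>born = verts G, live = {}, placed = edges G\<rparr>)"

lemma completable_move:
  assumes "completable G k c'" "legal G c m" "cost c m \<le> k" "apply_move c m = c'"
  shows "completable G k c"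
proof -
  from assms(1) obtain ms where "legal_from G c' ms" "\<forall>x\<in>set (costs_from c' ms). x \<le> k"
    "foldl apply_move c' ms = \<lparr>born = verts G, live = {}, placed = edges G\<rparr>"
    unfolding completable_def by blast
  then show ?thesis
    using assms(2-4) unfolding completable_def by (intro exI[of _ "m # ms"]) simp
qed

text \<open>Every close is now legal, and the first is the dearest at \<open>2 * card L - 1\<close>,
  whence the form of the bound.\<close>

lemma completable_all_placed:
  assumes "finite L" "2 * card L \<le> k + 1"
  shows "completable G k \<lparr>born = verts G, live = L, placed = edges G\<rparr>"
  using assms
proof (induction L)
  case empty
  show ?case unfolding completable_def by (intro exI[of _ "[]"]) simp
next
  case (insert X L)
  show ?case
    by (rule completable_move[OF insert.IH, where m = "Close X"])
      (use insert.hyps insert.prems in auto)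
qed

lemma completable_constructs:
  assumes "completable G k initial"
  shows "\<exists>ms. constructs ms G \<and> width ms \<le> k"
proof -
  from assms obtain ms where "legal_from G initial ms" "\<forall>x\<in>set (costs_from initial ms). x \<le> k"
    "foldl apply_move initial ms = \<lparr>born = verts G, live = {}, placed = edges G\<rparr>"
    unfolding completable_def by blast
  then have "constructs ms G" "width ms \<le> k"
    by (simp_all add: constructs_def is_play_def width_def)
  then show ?thesis by blast
qed

lemma lsfw_le:
  assumes "constructs ms G"
  shows "lsfw G \<le> width ms"
  unfolding lsfw_def using assms by (blast intro: Least_le)

text \<open>The given play makes the set of widths nonempty; otherwise \<open>LEAST\<close> would be
  unspecified.\<close>

lemma lsfw_attained:
  assumes "constructs ms G"
  shows "\<exists>ms. constructs ms G \<and> width ms = lsfw G"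
  unfolding lsfw_def
  by (rule LeastI[where P = "\<lambda>w. \<exists>ms. constructs ms G \<and> width ms = w"]) (use assms in blast)

text \<open>Each block of the explicit play has a singleton as first argument, so the simplifier can
  list its edges.\<close>

lemma pairs_between_singleton: "pairs_between {x} Y = (\<lambda>y. {x, y}) ` Y"
  by (auto simp: pairs_between_def)


section \<open>Row spaces over the two-element field and prefixes of linear orders\<close>

section \<open>Bounds for the rank\<close>

text \<open>Over the two-element field the span of f and g is exactly 0, f, g, f + g, so the four
  cases express membership in the span.\<close>

lemma rank_on_le_2:
  fixes A :: "'a \<Rightarrow> 'b \<Rightarrow> bit"
  assumes "\<And>i. i \<in> I \<Longrightarrow> (\<forall>j\<in>J. A i j = 0) \<or> (\<forall>j\<in>J. A i j = f j) \<or> (\<forall>j\<in>J. A i j = g j)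
      \<or> (\<forall>j\<in>J. A i j = f j + g j)"
  shows "rank_on I J A \<le> 2"
proof -
  let ?r = "\<lambda>h j. if j \<in> J then h j else (0::bit)"
  have span: "?r f \<in> bit_fun.span {?r f, ?r g}" "?r g \<in> bit_fun.span {?r f, ?r g}"
    by (rule bit_fun.span_base, simp)+
  have "?r (A i) \<in> bit_fun.span {?r f, ?r g}" if "i \<in> I" for i
  proof -
    have "?r (A i) = 0 \<or> ?r (A i) = ?r f \<or> ?r (A i) = ?r g \<or> ?r (A i) = ?r f + ?r g"
      using assms[OF that] by (auto simp: fun_eq_iff)
    then show ?thesis
      by (elim disjE) (simp_all only: span bit_fun.span_add[OF span] bit_fun.span_zero)
  qed
  then have "rank_on I J A \<le> card {?r f, ?r g}"
    unfolding rank_on_def by (intro bit_fun.dim_le_card) auto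
  also have "\<dots> \<le> 2" by (simp add: card_insert_if)
  finally show ?thesis .
qed

text \<open>Columns z and z' form an identity submatrix.\<close>

lemma rank_on_doubleton:
  assumes "z \<in> J" "A x z = 1" "A y z = 0" and "z' \<in> J" "A y z' = 1" "A x z' = 0"
  shows "rank_on {x, y} J A = 2"
proof -
  let ?f = "\<lambda>j. if j \<in> J then A x j else 0" and ?g = "\<lambda>j. if j \<in> J then A y j else 0"
  have f: "?f z = 1" "?g z = 0" and g: "?g z' = 1" "?f z' = 0" using assms by auto
  have ne: "?f \<noteq> ?g" using fun_cong[of ?f ?g z] f by auto
  have "?f \<notin> bit_fun.span {?g}"
  proof
    assume "?f \<in> bit_fun.span {?g}"
    then obtain k where k: "?f = (\<lambda>j. k * ?g j)" unfolding bit_fun.span_singleton by blast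
    show False using fun_cong[OF k, of z] f by simp
  qed
  moreover have "?g \<noteq> 0" using fun_cong[of ?g 0 z'] g by auto
  then have "bit_fun.independent {?g}" unfolding bit_fun.dependent_single .
  ultimately have "bit_fun.independent {?f, ?g}" by (rule bit_fun.independent_insertI)
  then have "bit_fun.dim {?f, ?g} = card {?f, ?g}" by (rule bit_fun.dim_eq_card_independent)
  then show ?thesis using ne by (simp add: rank_on_def)
qed

lemma finite_linear_orders:
  assumes "finite (verts G)"
  shows "finite (linear_orders G)"
proof -
  have "linear_orders G \<subseteq> {vs. set vs \<subseteq> verts G \<and> length vs \<le> card (verts G)}"
    by (auto simp: linear_orders_def distinct_card[symmetric])
  then show ?thesis using finite_lists_length_le[OF assms] finite_subset by blast
qed

lemma lrw_le:
  assumes "finite (verts G)" "vs \<in> linear_orders G"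
    and "\<And>i. i \<le> length vs \<Longrightarrow> cutrank G (set (take i vs)) \<le> k"
  shows "lrw G \<le> k"
proof -
  have "lrw G \<le> Max ((\<lambda>i. cutrank G (set (take i vs))) ` {0..length vs})"
    unfolding lrw_def using assms(2) finite_linear_orders[OF assms(1)] by (intro Min_le) auto
  also have "\<dots> \<le> k" using assms(3) by auto
  finally show ?thesis .
qed

text \<open>The prefix of length two suffices in every order: the two witnesses of incomparability
  are columns that separate its rows.\<close>

lemma lrw_ge_2:
  assumes G: "simple_graph G" "incomparable_nbhds G" "2 \<le> card (verts G)"
  shows "2 \<le> lrw G"
proof -
  have fin: "finite (verts G)" using G(1) by (simp add: simple_graph_def)
  have "2 \<le> Max ((\<lambda>i. cutrank G (set (take i vs))) ` {0..length vs})"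
    if vs: "vs \<in> linear_orders G" for vs
  proof -
    have len: "2 \<le> length vs" and d: "distinct vs" "set vs = verts G"
      using vs G(3) distinct_card[of vs] by (auto simp: linear_orders_def)
    then obtain x y vs' where xy: "vs = x # y # vs'" by (auto simp: numeral_2_eq_2 Suc_le_length_iff)
    have xyG: "x \<in> verts G" "y \<in> verts G" "x \<noteq> y" using d xy by auto
    note sep = G(2)[unfolded incomparable_nbhds_def, rule_format]
    obtain z where z: "z \<noteq> y" "{x, z} \<in> edges G" "{y, z} \<notin> edges G"
      using sep xyG by blast
    obtain z' where z': "z' \<noteq> x" "{y, z'} \<in> edges G" "{x, z'} \<notin> edges G"
      using sep xyG by metis
    have "u \<noteq> v \<and> v \<in> verts G" if "{u, v} \<in> edges G" for u v
      using G(1) that by (fastforce simp: simple_graph_def nsets_def card_insert_if)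
    \<comment> \<open>Absence of loops gives z distinct from x and z' distinct from y; the other
      inequalities are part of the witnesses.\<close>
    then have "z \<in> verts G - {x, y}" "z' \<in> verts G - {x, y}" using z z' by blast+
    then have "cutrank G {x, y} = 2"
      unfolding cutrank_def by (intro rank_on_doubleton[of z _ _ _ _ z'])
        (use z z' in \<open>simp_all add: adjacency_def\<close>)
    moreover have "set (take 2 vs) = {x, y}" by (simp add: xy)
    ultimately show ?thesis using len
      by (intro Max_ge) (auto intro!: image_eqI[of _ _ 2])
  qed
  moreover have "linear_orders G \<noteq> {}"
    using finite_distinct_list[OF fin] by (auto simp: linear_orders_def)
  ultimately show ?thesis
    unfolding lrw_def using finite_linear_orders[OF fin] by (intro Min.boundedI) auto
qed


section \<open>Adjacency in \<open>H7\<close>, an order of width 2 and a play of width 8\<close>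

section \<open>The complement of the seven-cycle\<close>

lemma verts_H7: "verts H7 = {0, 1, 2, 3, 4, 5, 6}"
  by (simp add: H7_def residues7)

lemma edges_H7: "edges H7 = {{0, 2}, {0, 3}, {0, 4}, {0, 5}, {1, 3}, {1, 4}, {1, 5}, {1, 6},
    {2, 4}, {2, 5}, {2, 6}, {3, 5}, {3, 6}, {4, 6}}" (is "_ = ?E")
proof -
  have *: "{u, v} \<in> ?E" if "u \<in> {0..<7}" "v \<in> {0..<7}" "cyclic_dist 7 u v \<in> {2, 3}" for u v
    using that unfolding residues7 cyclic_dist_def
    by (elim insertE emptyE; hypsubst; simp add: doubleton_eq_iff)
  have "?E \<subseteq> edges H7"
  proof -
    have E: "{u, v} \<in> edges H7" if "u \<in> {0..<7}" "v \<in> {0..<7}" "cyclic_dist 7 u v \<in> {2, 3}" for u v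
      using that unfolding H7_def by auto
    show ?thesis by (simp add: E cyclic_dist_def)
  qed
  moreover have "e \<in> ?E" if e: "e \<in> edges H7" for e
  proof -
    from e obtain u v where "e = {u, v}" "u \<in> {0..<7}" "v \<in> {0..<7}" "cyclic_dist 7 u v \<in> {2, 3}"
      unfolding H7_def by auto
    then show ?thesis using * by simp
  qed
  then have "edges H7 \<subseteq> ?E" by (rule subsetI)
  ultimately show ?thesis by (intro equalityI)
qed

lemma incomparable_nbhds_H7: "incomparable_nbhds H7"
proof -
  \<comment> \<open>Bounding z turns the existential into a finite disjunction that the simplifier
    can decide.\<close>
  have "\<exists>z\<in>{0, 1, 2, 3, 4, 5, 6}. z \<noteq> y \<and> {x, z} \<in> edges H7 \<and> {y, z} \<notin> edges H7"
    if "x \<in> verts H7" "y \<in> verts H7" "x \<noteq> y" for x y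
    using that unfolding verts_H7
    by (elim insertE emptyE) (simp_all add: edges_H7 doubleton_eq_iff)
  then show ?thesis unfolding incomparable_nbhds_def by blast
qed

lemma degree_H7: "\<forall>v\<in>verts H7. 4 \<le> card {u. {v, u} \<in> edges H7}"
  unfolding verts_H7 ball_simps
  by (intro conjI TrueI) (simp_all add: edges_H7 doubleton_eq_iff Collect_disj_eq)

lemma cutrank_H7_le:
  assumes "i \<le> 7"
  shows "cutrank H7 (set (take i [0, 1, 4, 3, 2, 5, 6])) \<le> 2"
proof -
  let ?A = "adjacency H7"
  \<comment> \<open>Each identity is stated on the columns left when its vertex joins the prefix, so
    it restricts to all longer prefixes. The rows of 0 and 1 span throughout.\<close>
  have rows: "\<forall>j\<in>{2, 3, 5, 6}. ?A 4 j = ?A 0 j + ?A 1 j" "\<forall>j\<in>{2, 5, 6}. ?A 3 j = ?A 1 j"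
    "\<forall>j\<in>{5, 6}. ?A 2 j = ?A 1 j" "?A 5 6 = 0"
    by (simp_all add: adjacency_def edges_H7 doubleton_eq_iff)
  have i: "i \<in> {0, 1, 2, 3, 4, 5, 6, 7}" using assms by auto
  show ?thesis
    unfolding cutrank_def
    by (insert i, elim insertE emptyE; rule rank_on_le_2[where f = "?A 0" and g = "?A 1"];
        use rows in \<open>force simp: verts_H7 insert_Diff_if\<close>)
qed

lemma lrw_H7: "lrw H7 = 2"
proof (rule antisym)
  show "lrw H7 \<le> 2"
    by (rule lrw_le[where vs = "[0, 1, 4, 3, 2, 5, 6]"])
      (use cutrank_H7_le in \<open>auto simp: verts_H7 linear_orders_def\<close>)
  show "2 \<le> lrw H7"
    by (rule lrw_ge_2) (simp_all add: simple_graph_H7 incomparable_nbhds_H7 verts_H7)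
qed

lemma completable_H7: "completable H7 8 initial"
  \<comment> \<open>The play is found by reading the moves from bottom to top.\<close>
proof -
  note step = completable_move[where G = H7 and k = 8]
  note eqs = verts_H7 edges_H7 pairs_between_singleton card_insert_if insert_Diff_if doubleton_eq_iff
    insert_commute
  \<comment> \<open>Only closes remain here; with four live cables they cost at most 7.\<close>
  have "completable H7 8 \<lparr>born = verts H7, live = {{6}, {4, 3, 1, 2}, {5}, {0}}, placed = edges H7\<rparr>"
    by (rule completable_all_placed) (simp_all add: card_insert_if)
  then have "completable H7 8 \<lparr>born = {6, 5, 4, 3, 2, 1, 0},
      live = {{6}, {4, 3, 1, 2}, {5}, {0}},
      placed = {{4, 6}, {3, 6}, {1, 6}, {2, 6}, {3, 5}, {1, 5}, {2, 5}, {0, 5}, {1, 4},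
        {2, 4}, {0, 4}, {1, 3}, {0, 3}, {0, 2}}\<rparr>"
    by (simp add: verts_H7 edges_H7 insert_commute)
  then have "completable H7 8 \<lparr>born = {6, 5, 4, 3, 2, 1, 0},
      live = {{6}, {4, 3, 1, 2}, {5}, {0}},
      placed = {{3, 5}, {1, 5}, {2, 5}, {0, 5}, {1, 4}, {2, 4}, {0, 4}, {1, 3}, {0, 3}, {0, 2}}\<rparr>"
    by (rule step[where m = "Block {6} {4, 3, 1, 2}"]) (simp_all add: eqs)
  then have "completable H7 8 \<lparr>born = {5, 4, 3, 2, 1, 0},
      live = {{4, 3, 1, 2}, {5}, {0}},
      placed = {{3, 5}, {1, 5}, {2, 5}, {0, 5}, {1, 4}, {2, 4}, {0, 4}, {1, 3}, {0, 3}, {0, 2}}\<rparr>"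
    by (rule step[where m = "Birth {6}"]) (simp_all add: eqs)
  \<comment> \<open>Every fold joins cables whose unplaced edges lead to the same vertices, so none
    dooms the play: 6 at this fold, 5 and 6 when 3 joins {1, 2}, and 4, 5, 6 when 1 joins 2.\<close>
  then have "completable H7 8 \<lparr>born = {5, 4, 3, 2, 1, 0},
      live = {{5}, {3, 1, 2}, {4}, {0}},
      placed = {{3, 5}, {1, 5}, {2, 5}, {0, 5}, {1, 4}, {2, 4}, {0, 4}, {1, 3}, {0, 3}, {0, 2}}\<rparr>"
    by (rule step[where m = "Fold {4} {3, 1, 2}"]) (simp_all add: eqs)
  then have "completable H7 8 \<lparr>born = {5, 4, 3, 2, 1, 0},
      live = {{5}, {3, 1, 2}, {4}, {0}},
      placed = {{0, 5}, {1, 4}, {2, 4}, {0, 4}, {1, 3}, {0, 3}, {0, 2}}\<rparr>"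
    by (rule step[where m = "Block {5} {3, 1, 2}"]) (simp_all add: eqs)
  then have "completable H7 8 \<lparr>born = {5, 4, 3, 2, 1, 0},
      live = {{5}, {3, 1, 2}, {4}, {0}},
      placed = {{1, 4}, {2, 4}, {0, 4}, {1, 3}, {0, 3}, {0, 2}}\<rparr>"
    by (rule step[where m = "Block {5} {0}"]) (simp_all add: eqs)
  then have "completable H7 8 \<lparr>born = {4, 3, 2, 1, 0},
      live = {{3, 1, 2}, {4}, {0}},
      placed = {{1, 4}, {2, 4}, {0, 4}, {1, 3}, {0, 3}, {0, 2}}\<rparr>"
    by (rule step[where m = "Birth {5}"]) (simp_all add: eqs)
  then have "completable H7 8 \<lparr>born = {4, 3, 2, 1, 0},
      live = {{4}, {1, 2}, {3}, {0}},
      placed = {{1, 4}, {2, 4}, {0, 4}, {1, 3}, {0, 3}, {0, 2}}\<rparr>"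
    by (rule step[where m = "Fold {3} {1, 2}"]) (simp_all add: eqs)
  then have "completable H7 8 \<lparr>born = {4, 3, 2, 1, 0},
      live = {{4}, {1, 2}, {3}, {0}},
      placed = {{0, 4}, {1, 3}, {0, 3}, {0, 2}}\<rparr>"
    by (rule step[where m = "Block {4} {1, 2}"]) (simp_all add: eqs)
  then have "completable H7 8 \<lparr>born = {4, 3, 2, 1, 0},
      live = {{4}, {1, 2}, {3}, {0}},
      placed = {{1, 3}, {0, 3}, {0, 2}}\<rparr>"
    by (rule step[where m = "Block {4} {0}"]) (simp_all add: eqs)
  then have "completable H7 8 \<lparr>born = {3, 2, 1, 0},
      live = {{1, 2}, {3}, {0}},
      placed = {{1, 3}, {0, 3}, {0, 2}}\<rparr>"
    by (rule step[where m = "Birth {4}"]) (simp_all add: eqs)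
  then have "completable H7 8 \<lparr>born = {3, 2, 1, 0},
      live = {{3}, {2}, {1}, {0}},
      placed = {{1, 3}, {0, 3}, {0, 2}}\<rparr>"
    by (rule step[where m = "Fold {1} {2}"]) (simp_all add: eqs)
  then have "completable H7 8 \<lparr>born = {3, 2, 1, 0},
      live = {{3}, {2}, {1}, {0}},
      placed = {{0, 3}, {0, 2}}\<rparr>"
    by (rule step[where m = "Block {3} {1}"]) (simp_all add: eqs)
  then have "completable H7 8 \<lparr>born = {3, 2, 1, 0},
      live = {{3}, {2}, {1}, {0}},
      placed = {{0, 2}}\<rparr>"
    by (rule step[where m = "Block {3} {0}"]) (simp_all add: eqs)
  then have "completable H7 8 \<lparr>born = {2, 1, 0},
      live = {{2}, {1}, {0}},
      placed = {{0, 2}}\<rparr>"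
    by (rule step[where m = "Birth {3}"]) (simp_all add: eqs)
  then have "completable H7 8 \<lparr>born = {2, 1, 0}, live = {{2}, {1}, {0}}, placed = {}\<rparr>"
    by (rule step[where m = "Block {0} {2}"]) (simp_all add: eqs)
  then have "completable H7 8 \<lparr>born = {1, 0}, live = {{1}, {0}}, placed = {}\<rparr>"
    by (rule step[where m = "Birth {2}"]) (simp_all add: eqs)
  then have "completable H7 8 \<lparr>born = {0}, live = {{0}}, placed = {}\<rparr>"
    by (rule step[where m = "Birth {1}"]) (simp_all add: eqs)
  then show ?thesis
    by (rule step[where m = "Birth {0}"]) (simp_all add: initial_def eqs)
qed

lemma lsfw_H7: "lsfw H7 = 8"
proof (rule antisym)
  obtain ms where ms: "constructs ms H7" "width ms \<le> 8"
    using completable_constructs[OF completable_H7] by blast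
  then show "lsfw H7 \<le> 8" using lsfw_le[of ms H7] by simp
  have "8 \<le> width ms'" if "constructs ms' H7" for ms'
    using that by (intro width_ge_8[OF simple_graph_H7 incomparable_nbhds_H7 _ degree_H7])
      (simp_all add: verts_H7)
  then show "8 \<le> lsfw H7" using lsfw_attained[OF ms(1)] by metis
qed

theorem theorem5p7:
  shows "lrw H7 = 2 \<and> lsfw H7 = 8 \<and>
    \<not> (\<forall>G :: int ugraph. simple_graph G \<longrightarrow> lsfw G \<le> 2 * lrw G + 2)"
  \<comment> \<open>The graph \<open>H7\<close> refutes the inequality, since 8 exceeds 2 * 2 + 2 =
    6.\<close>
  using lrw_H7 lsfw_H7 simple_graph_H7 by (auto intro!: exI[of _ H7])

end
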